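(* Let $q$ be a prime power, $\alpha,\beta\in\mathbb{F}_{q^5}$, and let $$L_{\alpha,\beta}=\{\langle(x-\alpha x^{q^2},\,x^q-\beta x^{q^2})\rangle_{\mathbb{F}_{q^5}}: x\in\mathbb{F}_{q^5}^*\}.$$ (i) The linear set $L_{\alpha,\beta}$ has rank less than five if and only if $\alpha^q=\beta^{q+1}$ and $\mathrm{N}(\alpha)=\mathrm{N}(\beta)=1$. (ii) If $\alpha^q\neq\beta^{q+1}$, then $L_{\alpha,\beta}$ is not of pseudoregulus type. (iii) If $\alpha^q=\beta^{q+1}$ and $(\mathrm{N}(\alpha),\mathrm{N}(\beta))\neq(1,1)$, then $L_{\alpha,\beta}$ is of pseudoregulus type.
   Context: $L_{\alpha,\beta}$ is the $\mathbb{F}_q$-linear set in $\mathrm{PG}(1,q^5)$ associated with the $\mathbb{F}_q$-subspace $U_{\alpha,\beta}=\{(x-\alpha x^{q^2},x^q-\beta x^{q^2}): x\in\mathbb{F}_{q^5}\}$ of $\mathbb{F}_{q^5}^2$, i.e. the set of points $\langle v\rangle_{\mathbb{F}_{q^5}}$ with $v\in U_{\alpha,\beta}\setminus\{0\}$ (only nonzero vectors are considered); its rank is $\dim_{\mathbb{F}_q}U_{\alpha,\beta}$. A linear set in $\mathrm{PG}(1,q^5)$ is of pseudoregulus type if it is projectively equivalent (under $\mathrm{PGL}(2,q^5)$) to $\{\langle(u,u^q)\rangle_{\mathbb{F}_{q^5}}: u\in\mathbb{F}_{q^5}^*\}$. $\mathrm{N}$ is the norm from $\mathbb{F}_{q^5}$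 to $\mathbb{F}_q$. *)

theory Defs
  imports "HOL-Analysis.Analysis" "HOL-Number_Theory.Prime_Powers"
begin

text \<open>
  A field extension is an embedding \<open>\<iota> :: 'k \<Rightarrow> 'a\<close> of fields.  For \<open>CARD('k) = q\<close> and
  \<open>CARD('a) = q ^ 5\<close> this is the extension of the field with \<open>q ^ 5\<close> elements over the one with
  \<open>q\<close> elements.
\<close>

definition field_embedding :: "('k::field \<Rightarrow> 'a::field) \<Rightarrow> bool" where
  "field_embedding \<iota> \<longleftrightarrow>
     \<iota> 1 = 1 \<and> (\<forall>x y. \<iota> (x + y) = \<iota> x + \<iota> y) \<and> (\<forall>x y. \<iota> (x * y) = \<iota> x * \<iota> y)"

text \<open>The action of \<open>'k\<close> on the plane \<open>'a ^ 2\<close> by restriction of scalars.\<close>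

definition restr_scale :: "('k::field \<Rightarrow> 'a::field) \<Rightarrow> 'k \<Rightarrow> 'a ^ 2 \<Rightarrow> 'a ^ 2" where
  "restr_scale \<iota> c v = \<iota> c *s v"

lemma vector_space_restr_scale:
  assumes "field_embedding \<iota>"
  shows "vector_space (restr_scale \<iota>)"
  using assms unfolding field_embedding_def restr_scale_def
  by unfold_locales (simp_all add: vec.scale_right_distrib vec.scale_left_distrib)

text \<open>The points of the projective line over \<open>'a\<close> are the one-dimensional subspaces of \<open>'a ^ 2\<close>.\<close>

definition linear_set :: "('a::field ^ 2) set \<Rightarrow> ('a ^ 2) set set" where
  "linear_set U = {vec.span {v} | v. v \<in> U \<and> v \<noteq> 0}"

text \<open>
  The rank belongs to the subspace \<open>U\<close> defining a linear set and is not determined by the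
  point set alone.
\<close>

definition linear_set_rank :: "('k::field \<Rightarrow> 'a::field) \<Rightarrow> ('a ^ 2) set \<Rightarrow> nat" where
  "linear_set_rank \<iota> U = vector_space.dim (restr_scale \<iota>) U"

definition proj_equivalent :: "('a::field ^ 2) set set \<Rightarrow> ('a ^ 2) set set \<Rightarrow> bool" where
  "proj_equivalent L L' \<longleftrightarrow>
     (\<exists>A :: 'a ^ 2 ^ 2. invertible A \<and> L' = (\<lambda>P. (\<lambda>v. A *v v) ` P) ` L)"

definition pseudoregulus_type :: "nat \<Rightarrow> ('a::field ^ 2) set set \<Rightarrow> bool" where
  "pseudoregulus_type q L \<longleftrightarrow>
     proj_equivalent L {vec.span {vector [u, u ^ q]} | u :: 'a. u \<noteq> 0}"

definition U_set :: "nat \<Rightarrow> 'a::field \<Rightarrow> 'a \<Rightarrow> ('a ^ 2) set" where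
  "U_set q \<alpha> \<beta> =
     {vector [x - \<alpha> * x ^ (q ^ 2), x ^ q - \<beta> * x ^ (q ^ 2)] | x. True}"

definition L_set :: "nat \<Rightarrow> 'a::field \<Rightarrow> 'a \<Rightarrow> ('a ^ 2) set set" where
  "L_set q \<alpha> \<beta> = linear_set (U_set q \<alpha> \<beta>)"

text \<open>
  The norm to the subfield with \<open>q\<close> elements, as the product of the conjugates under the
  \<open>q\<close>-Frobenius map, which generates the Galois group.  Its value is taken in \<open>'a\<close>.
\<close>

definition norm5 :: "nat \<Rightarrow> 'a::field \<Rightarrow> 'a" where
  "norm5 q x = (\<Prod>i<5. x ^ (q ^ i))"

end

theory Submission
  imports Defs
begin

text \<open>
Write \<open>f x = x - \<alpha> * x ^ q\<^sup>2\<close> and \<open>g x = x ^ q - \<beta> * x ^ q\<^sup>2\<close>, so that the points of \<open>L_set q \<alpha> \<beta>\<close> are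
spanned by the nonzero vectors \<open>(f x, g x)\<close>.

The rank drops below five exactly when \<open>f\<close> and \<open>g\<close> have a common nonzero root \<open>x\<close>, that is, when
\<open>\<alpha> = x / x ^ q\<^sup>2\<close> and \<open>\<beta> = x ^ q / x ^ q\<^sup>2\<close>.  Hilbert 90 for \<open>\<beta>\<close> turns this into the norm conditions
(\<open>common_root_iff\<close>); dimensions are compared by counting vectors (\<open>card_subspace\<close>).

If \<open>\<alpha> ^ q = \<beta> ^ (q + 1)\<close>, put \<open>\<gamma> ^ q = \<beta>\<close> and \<open>h x = x - \<gamma> * x ^ q\<close>.  Then \<open>g = h ^ q\<close> and
\<open>f = h + \<gamma> * g\<close>, so a shear maps \<open>(f, g)\<close> to \<open>(h, h ^ q)\<close>.  The
hypothesis also makes the norm of \<open>\<alpha>\<close> the square of that of \<open>\<beta>\<close>, so if the norms are not both \<open>1\<close>,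
that of \<open>\<beta>\<close> is not \<open>1\<close>.  Then \<open>h\<close> is bijective and the image is \<open>{(u, u ^ q)}\<close>.

Now let \<open>\<alpha> ^ q \<noteq> \<beta> ^ (q + 1)\<close>, so that \<open>f\<close> and \<open>g\<close> have no common nonzero root, and suppose that a
projectivity takes \<open>(f, g)\<close> to \<open>(F, G)\<close> with the point set of \<open>{(u, u ^ q)}\<close>.  Since that set does not
contain \<open>(0, 1)\<close>, \<open>F\<close> has no nonzero root and is bijective, and \<open>\<Phi> = G \<circ> F\<^sup>-\<^sup>1\<close> is a \<open>q\<close>-polynomial because \<open>F\<^sup>-\<^sup>1\<close> is an
iterate of \<open>F\<close>.  The slopes \<open>\<Phi> y / y\<close> are precisely the elements \<open>u ^ q / u\<close>.  Every slope of a
\<open>q\<close>-polynomial is attained \<open>-1\<close> times modulo the characteristic, so the power sums of the slopes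
depend on the set of slopes alone.  The power sums of exponents \<open>1\<close>, \<open>1 + q\<close>, \<open>1 + q\<^sup>2\<close>, \<open>1 + q + q\<^sup>2\<close>
and \<open>1 + q + q\<^sup>3\<close> are, up to sign, \<open>3 \<times> 3\<close> permanents in the conjugates of the coefficients
(\<open>column_permanent_eq_power_sum\<close>).  Comparing them with those of \<open>u ^ q\<close> leaves \<open>\<Phi>\<close> a single term
\<open>l * y ^ q ^ m\<close> with \<open>1 \<le> m \<le> 4\<close> (\<open>monomial_if_frobenius_slopes\<close>).  Hence \<open>G = l * F ^ q ^ m\<close>.
Since \<open>F\<close> and \<open>G\<close> are independent combinations of \<open>f\<close> and \<open>g\<close>, which have only the terms \<open>x\<close>, \<open>x ^ q\<close>
and \<open>x ^ q\<^sup>2\<close>, comparing coefficients forces \<open>\<alpha> ^ q = \<beta> ^ (q + 1)\<close>, a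
contradiction.
\<close>

section \<open>Finite fields and counting in vector spaces\<close>

lemma finite_field_power_card:
  fixes x :: "'b::field"
  assumes "finite (UNIV :: 'b set)"
  shows "x ^ CARD('b) = x"
proof (cases "x = 0")
  case True
  then show ?thesis
    using assms by (simp add: power_0_left card_eq_0_iff)
next
  case False
  have "(\<Prod>y\<in>UNIV-{0}. x * y) = (\<Prod>y\<in>UNIV-{0}. y)"
    by (rule prod.reindex_bij_witness[of _ "\<lambda>y. y / x" "\<lambda>y. x * y"]) (use False in auto)
  then have "x ^ (CARD('b) - 1) * \<Prod>(UNIV-{0}) = \<Prod>(UNIV-{0::'b})"
    using assms by (simp add: prod.distrib card_Diff_singleton)
  moreover have "\<Prod>(UNIV-{0::'b}) \<noteq> 0"
    using assms by (simp add: prod_zero_iff)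
  ultimately have "x ^ (CARD('b) - 1) = 1"
    by simp
  moreover have "CARD('b) = Suc (CARD('b) - 1)"
    using assms by (simp add: card_gt_0_iff)
  ultimately show ?thesis
    by (metis power_Suc mult_1_right)
qed

text \<open>
Translating \<open>K\<close> by one of its elements \<open>x\<close> does not change the sum of \<open>K\<close> but adds \<open>card K * x\<close>.
This is the form of ``a nontrivial subgroup has order divisible by the characteristic'' that is
needed, and it also shows that the order of the field vanishes in the field.
\<close>

lemma additive_subgroup_card_zero:
  fixes K :: "'b::field set"
  assumes "finite K" "x \<in> K" "x \<noteq> 0"
    and add: "\<And>y z. y \<in> K \<Longrightarrow> z \<in> K \<Longrightarrow> y + z \<in> K"
    and diff: "\<And>y z. y \<in> K \<Longrightarrow> z \<in> K \<Longrightarrow> y - z \<in> K"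
  shows "of_nat (card K) = (0::'b)"
proof -
  have "(\<Sum>y\<in>K. y + x) = (\<Sum>y\<in>K. y)"
    by (rule sum.reindex_bij_witness[of _ "\<lambda>y. y - x" "\<lambda>y. y + x"]) (use assms in auto)
  then have "of_nat (card K) * x = 0"
    by (simp add: sum.distrib)
  with \<open>x \<noteq> 0\<close> show ?thesis
    by simp
qed

lemma (in vector_space) card_span_independent:
  assumes "finite (UNIV :: 'a set)" "finite B" "\<not> dependent B"
  shows "card (span B) = CARD('a) ^ card B"
proof -
  have "bij_betw (\<lambda>c. \<Sum>b\<in>B. scale (c b) b) (B \<rightarrow>\<^sub>E UNIV) (span B)"
  proof (rule bij_betw_imageI)
    show "inj_on (\<lambda>c. \<Sum>b\<in>B. scale (c b) b) (B \<rightarrow>\<^sub>E UNIV)"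
    proof (rule inj_onI)
      fix c d :: "'b \<Rightarrow> 'a"
      assume c: "c \<in> B \<rightarrow>\<^sub>E UNIV" and d: "d \<in> B \<rightarrow>\<^sub>E UNIV"
        and "(\<Sum>b\<in>B. scale (c b) b) = (\<Sum>b\<in>B. scale (d b) b)"
      then have "(\<Sum>b\<in>B. scale (c b - d b) b) = 0"
        by (simp add: scale_left_diff_distrib sum_subtractf)
      then have "c b - d b = 0" if "b \<in> B" for b
        by (rule independentD[OF assms(3,2) order_refl _ that])
      then show "c = d"
        using c d by (intro PiE_ext) auto
    qed
    show "(\<lambda>c. \<Sum>b\<in>B. scale (c b) b) ` (B \<rightarrow>\<^sub>E UNIV) = span B"
    proof -
      have "(\<Sum>b\<in>B. scale (c b) b) \<in> (\<lambda>c. \<Sum>b\<in>B. scale (c b) b) ` (B \<rightarrow>\<^sub>E UNIV)" for c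
        by (rule image_eqI[of _ _ "restrict c B"]) auto
      then show ?thesis
        unfolding span_finite[OF assms(2)] by blast
    qed
  qed
  then show ?thesis
    using assms(2) by (simp add: bij_betw_same_card[symmetric] card_PiE)
qed

lemma (in vector_space) card_subspace:
  assumes "finite (UNIV :: 'a set)" "finite V" "subspace V"
  shows "card V = CARD('a) ^ dim V"
proof -
  obtain B where B: "B \<subseteq> V" "\<not> dependent B" "V \<subseteq> span B" "card B = dim V"
    using basis_exists by blast
  then have "span B = V"
    using assms(3) span_minimal by blast
  moreover have "finite B"
    using B(1) assms(2) finite_subset by blast
  ultimately show ?thesis
    using card_span_independent[OF assms(1) _ B(2)] B(4) by metis
qed

section \<open>Linearized polynomials over the field of order q^5\<close>

text \<open>
The reduced linearized polynomial (\<open>q\<close>-polynomial) with coefficients \<open>a 0, \<dots>, a 4\<close>; five terms are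
enough, since \<open>x ^ q ^ 5 = x\<close>.
\<close>

definition lin_poly :: "nat \<Rightarrow> (nat \<Rightarrow> 'a::field) \<Rightarrow> 'a \<Rightarrow> 'a" where
  "lin_poly q a x = (\<Sum>i<5. a i * x ^ (q ^ i))"

text \<open>
The coefficients of the \<open>q ^ s\<close>-th power of a \<open>q\<close>-polynomial: they are conjugated and moved
cyclically by \<open>s\<close> places.  The summand \<open>5\<close> keeps the difference from being truncated for \<open>s \<le> 5\<close>.
\<close>

definition frobenius_twist :: "nat \<Rightarrow> nat \<Rightarrow> (nat \<Rightarrow> 'a::field) \<Rightarrow> nat \<Rightarrow> 'a" where
  "frobenius_twist q s a i = a ((i + 5 - s) mod 5) ^ (q ^ s)"

locale quintic_field =
  fixes q :: nat and ty :: "'a::field itself"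
  assumes primepow_q: "primepow q" and card_field: "CARD('a) = q ^ 5"
begin

lemma q_ge_2: "q \<ge> 2"
  using primepow_gt_Suc_0[OF primepow_q] by simp

lemma finite_subset_field: "finite (S :: 'a set)"
proof -
  have "CARD('a) > 0" using card_field q_ge_2 by simp
  then show ?thesis using finite_subset[of S UNIV] by (simp add: card_gt_0_iff)
qed

lemma of_nat_q: "of_nat q = (0::'a)"
proof -
  have "of_nat (CARD('a)) = (0::'a)"
    by (rule additive_subgroup_card_zero[where x = 1]) (auto simp: finite_subset_field)
  then show ?thesis
    by (simp add: card_field)
qed

lemma frobenius_sum: "(\<Sum>i\<in>I. g i) ^ (q ^ s) = (\<Sum>i\<in>I. (g i :: 'a) ^ (q ^ s))"
proof -
  have p: "prime CHAR('a)"
    by (intro prime_CHAR_semidom finite_imp_CHAR_pos finite_subset_field)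
  obtain p k where pk: "prime p" "q = p ^ k" "k > 0"
    using primepow_q by (auto simp: primepow_def)
  have "CHAR('a) dvd q"
    using of_nat_q by (simp add: of_nat_eq_0_iff_char_dvd)
  then have "CHAR('a) dvd p"
    unfolding pk(2) by (rule prime_dvd_power[OF p])
  then have "CHAR('a) = p"
    by (rule primes_dvd_imp_eq[OF p pk(1)])
  then have "q ^ s = CHAR('a) ^ (k * s)"
    by (simp add: pk power_mult)
  then show ?thesis
    by (rule freshmans_dream_sum'[OF p])
qed

lemma frobenius_add: "(x + y :: 'a) ^ (q ^ s) = x ^ (q ^ s) + y ^ (q ^ s)"
  using frobenius_sum[of "\<lambda>i. if i then x else y" UNIV s] by (simp add: UNIV_bool add.commute)

lemma frobenius_diff: "(x - y :: 'a) ^ (q ^ s) = x ^ (q ^ s) - y ^ (q ^ s)"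
  using frobenius_add[of "x - y" y s] by (simp add: algebra_simps)

lemma frobenius_order_5: "(x::'a) ^ (q ^ 5) = x"
  using finite_field_power_card[of x] finite_subset_field card_field by simp

lemma frobenius_mod_5: "(x::'a) ^ (q ^ (i mod 5)) = x ^ (q ^ i)"
proof -
  have "x ^ (q ^ (5 * k)) = x" for k
    by (induction k) (simp_all add: power_add power_mult frobenius_order_5)
  then have "(x ^ (q ^ (5 * (i div 5)))) ^ (q ^ (i mod 5)) = x ^ (q ^ (i mod 5))"
    by (rule arg_cong)
  then show ?thesis
    by (simp only: mult_div_mod_eq flip: power_mult power_add)
qed

lemma frobenius_inj: "(x::'a) ^ (q ^ s) = y ^ (q ^ s) \<longleftrightarrow> x = y"
  using frobenius_diff[of x y s] by auto

lemma lin_poly_add: "lin_poly q a (x + y :: 'a) = lin_poly q a x + lin_poly q a y"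
  by (simp add: lin_poly_def frobenius_add sum.distrib algebra_simps)

lemma lin_poly_diff: "lin_poly q a (x - y :: 'a) = lin_poly q a x - lin_poly q a y"
  by (simp add: lin_poly_def frobenius_diff sum_subtractf algebra_simps)

lemma lin_poly_frobenius:
  assumes "s \<le> 5"
  shows "lin_poly q a (x::'a) ^ (q ^ s) = lin_poly q (frobenius_twist q s a) x"
proof -
  have "lin_poly q a x ^ (q ^ s) = (\<Sum>i<5. a i ^ (q ^ s) * x ^ (q ^ (i + s)))"
    by (simp add: lin_poly_def frobenius_sum power_mult_distrib power_add flip: power_mult)
  also have "\<dots> = (\<Sum>i<5. a ((i + 5 - s) mod 5) ^ (q ^ s) * x ^ (q ^ i))"
  proof (rule sum.reindex_bij_witness[of _ "\<lambda>i. (i + 5 - s) mod 5" "\<lambda>i. (i + s) mod 5"])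
    fix i :: nat assume "i \<in> {..<5}"
    then have i: "i < 5" by simp
    have "((i + s) mod 5 + 5 - s) mod 5 = ((i + s) mod 5 + (5 - s)) mod 5"
      using assms by simp
    also have "\<dots> = (i + s + (5 - s)) mod 5"
      by (rule mod_add_left_eq)
    also have "\<dots> = i"
      using i assms by simp
    finally show 1: "((i + s) mod 5 + 5 - s) mod 5 = i" .
    have "((i + 5 - s) mod 5 + s) mod 5 = (i + 5 - s + s) mod 5"
      by (rule mod_add_left_eq)
    also have "\<dots> = i"
      using i assms by simp
    finally show "((i + 5 - s) mod 5 + s) mod 5 = i" .
    show "a (((i + s) mod 5 + 5 - s) mod 5) ^ q ^ s * x ^ q ^ ((i + s) mod 5)
        = a i ^ q ^ s * x ^ q ^ (i + s)"
      unfolding 1 frobenius_mod_5 ..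
  qed auto
  finally show ?thesis
    by (simp add: lin_poly_def frobenius_twist_def)
qed

lemma lin_poly_comp: "\<exists>c. \<forall>x::'a. lin_poly q a (lin_poly q b x) = lin_poly q c x"
proof -
  have "lin_poly q a (lin_poly q b x) = lin_poly q (\<lambda>j. \<Sum>i<5. a i * frobenius_twist q i b j) x"
    for x :: 'a
  proof -
    have "lin_poly q a (lin_poly q b x) = (\<Sum>i<5. a i * lin_poly q (frobenius_twist q i b) x)"
      unfolding lin_poly_def[of q a] by (intro sum.cong) (auto simp: lin_poly_frobenius)
    also have "\<dots> = (\<Sum>i<5. \<Sum>j<5. a i * frobenius_twist q i b j * x ^ (q ^ j))"
      by (simp only: lin_poly_def sum_distrib_left mult.assoc)
    also have "\<dots> = (\<Sum>j<5. \<Sum>i<5. a i * frobenius_twist q i b j * x ^ (q ^ j))"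
      by (rule sum.swap)
    also have "\<dots> = lin_poly q (\<lambda>j. \<Sum>i<5. a i * frobenius_twist q i b j) x"
      by (simp only: lin_poly_def sum_distrib_right)
    finally show ?thesis .
  qed
  then show ?thesis
    by blast
qed

lemma lin_poly_unit: "k < 5 \<Longrightarrow> lin_poly q (\<lambda>i. if i = k then 1 else 0) (x::'a) = x ^ (q ^ k)"
proof -
  assume k: "k < 5"
  have "lin_poly q (\<lambda>i. if i = k then 1 else 0) x = (\<Sum>i<5. if i = k then x ^ (q ^ i) else 0)"
    unfolding lin_poly_def by (intro sum.cong) auto
  also have "\<dots> = x ^ (q ^ k)"
    using k by (simp only: sum.delta finite_lessThan lessThan_iff if_True)
  finally show ?thesis .
qed

text \<open>
An injective self-map of a finite set has finite order, so its inverse is one of its iterates, and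
\<open>q\<close>-polynomials are closed under composition.
\<close>

lemma lin_poly_left_inverse:
  assumes "inj (lin_poly q a :: 'a \<Rightarrow> 'a)"
  shows "\<exists>b. \<forall>x::'a. lin_poly q b (lin_poly q a x) = x"
proof -
  let ?F = "lin_poly q a :: 'a \<Rightarrow> 'a"
  have iterate: "\<exists>b. \<forall>x. (?F ^^ n) x = lin_poly q b x" for n
  proof (induction n)
    case 0
    show ?case
      using lin_poly_unit[of 0] by (intro exI[of _ "\<lambda>i. if i = 0 then 1 else 0"]) simp
  next
    case (Suc n)
    then show ?case
      using lin_poly_comp[of a] by (simp only: funpow.simps comp_apply) metis
  qed
  \<comment> \<open>Iterating composition with \<open>F\<close> on the finite set of all maps gives one exponent that works for every point.\<close>
  have funpow_comp: "(((\<circ>) ?F) ^^ n) id = ?F ^^ n" for n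
    by (induction n) auto
  have "inj ((\<circ>) ?F :: ('a \<Rightarrow> 'a) \<Rightarrow> _)"
    using assms by (auto simp: inj_def fun_eq_iff)
  moreover have "finite (S :: ('a \<Rightarrow> 'a) set)" for S
  proof -
    have "finite (UNIV :: ('a \<Rightarrow> 'a) set)"
      by (simp add: finite_UNIV_fun finite_subset_field)
    then show ?thesis
      by (rule finite_subset[OF subset_UNIV])
  qed
  ultimately obtain n where n: "n > 0" "(((\<circ>) ?F) ^^ n) id = id"
    using funpow_inj_finite[of "(\<circ>) ?F" id] by metis
  obtain m where "n = Suc m"
    using n(1) gr0_conv_Suc by blast
  then have "(?F ^^ m) \<circ> ?F = id"
    using n(2) unfolding funpow_comp by (simp only: funpow_Suc_right)
  then have "(?F ^^ m) (?F x) = x" for x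
    by (simp only: fun_eq_iff comp_apply id_apply)
  then show ?thesis
    using iterate[of m] by metis
qed

text \<open>
A \<open>q\<close>-polynomial has degree at most \<open>q ^ 4\<close>, which is less than the number of points at which two
of them are assumed to agree.
\<close>

lemma lin_poly_eqD:
  assumes "\<And>x::'a. lin_poly q a x = lin_poly q b x" and "i < 5"
  shows "a i = b i"
proof -
  define P where "P = (\<lambda>a::nat \<Rightarrow> 'a. \<Sum>i<5. monom (a i) (q ^ i))"
  have poly_P: "poly (P a) x = lin_poly q a x" for a x
    by (simp add: P_def lin_poly_def poly_sum poly_monom)
  have pow: "q ^ j < q ^ 5" if "j < 5" for j
    using q_ge_2 that by simp
  have "degree (P a) < q ^ 5" for a
    unfolding P_def using q_ge_2 pow
    by (intro degree_sum_less) (auto intro: le_less_trans[OF degree_monom_le])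
  then have "P a = P b"
    using assms(1) by (intro poly_eqI_degree[of UNIV]) (auto simp: poly_P card_field)
  moreover have "coeff (P a) (q ^ i) = a i" for a
    using \<open>i < 5\<close> q_ge_2 by (simp add: P_def coeff_sum coeff_monom sum.delta)
  ultimately show ?thesis
    by metis
qed

text \<open>
Orthogonality of the characters \<open>x \<mapsto> x ^ A\<close> of the multiplicative group.  If the exponents differ
modulo \<open>q ^ 5 - 1\<close>, some \<open>w\<close> separates the characters, by counting roots, and the substitution of
\<open>w * x\<close> for \<open>x\<close> shows that the sum vanishes.
\<close>

lemma power_ratio_sum:
  "(\<Sum>x\<in>-{0::'a}. x ^ A / x ^ B) = (if A mod (q ^ 5 - 1) = B mod (q ^ 5 - 1) then -1 else 0)"
proof -
  define N where "N = q ^ 5 - 1"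
  have "q ^ 5 > 1"
    using q_ge_2 by (intro one_less_power) auto
  then have N: "q ^ 5 = Suc N" "N > 0"
    by (auto simp: N_def)
  have pow_N: "x ^ N = 1" if "x \<noteq> 0" for x :: 'a
    using frobenius_order_5[of x] that by (simp add: N)
  have pow_mod: "x ^ (m mod N) = x ^ m" if "x \<noteq> 0" for x :: 'a and m
  proof -
    have "x ^ m = x ^ (N * (m div N) + m mod N)"
      by simp
    also have "\<dots> = x ^ (m mod N)"
      by (simp only: power_add power_mult pow_N[OF that] power_one mult_1)
    finally show ?thesis ..
  qed
  have card: "card (-{0::'a}) = N"
    using card_Diff_singleton[of "0::'a" UNIV] by (simp add: card_field N Compl_eq_Diff_UNIV)
  show ?thesis
  proof (cases "A mod N = B mod N")
    case True
    then have "x ^ A / x ^ B = 1" if "x \<noteq> 0" for x :: 'a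
      using pow_mod[OF that, of A] pow_mod[OF that, of B] that by simp
    then have "(\<Sum>x\<in>-{0::'a}. x ^ A / x ^ B) = of_nat N"
      by (simp add: card)
    also have "\<dots> = of_nat (q ^ 5) - 1"
      by (simp add: N)
    finally show ?thesis
      using True by (simp add: of_nat_q N_def)
  next
    case False
    have "\<exists>w::'a. w \<noteq> 0 \<and> w ^ A \<noteq> w ^ B"
    proof (rule ccontr)
      assume "\<not> ?thesis"
      then have "monom 1 (A mod N) = (monom 1 (B mod N) :: 'a poly)"
        using N(2) pow_mod
        by (intro poly_eqI_degree[of "-{0}"]) (auto simp: poly_monom degree_monom_eq card)
      then show False
        using False by (metis degree_monom_eq one_neq_zero)
    qed
    then obtain w :: 'a where w: "w \<noteq> 0" "w ^ A \<noteq> w ^ B" by blast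
    have "(\<Sum>x\<in>-{0::'a}. x ^ A / x ^ B) = (\<Sum>x\<in>-{0}. (w * x) ^ A / (w * x) ^ B)"
      by (rule sum.reindex_bij_witness[of _ "\<lambda>x. w * x" "\<lambda>x. x / w"]) (use w in auto)
    also have "\<dots> = w ^ A / w ^ B * (\<Sum>x\<in>-{0::'a}. x ^ A / x ^ B)"
      by (simp add: power_mult_distrib sum_distrib_left)
    finally have "(w ^ A / w ^ B - 1) * (\<Sum>x\<in>-{0::'a}. x ^ A / x ^ B) = 0"
      by (simp add: algebra_simps)
    moreover have "w ^ A / w ^ B - 1 \<noteq> 0"
      using w by simp
    ultimately have "(\<Sum>x\<in>-{0::'a}. x ^ A / x ^ B) = 0"
      using mult_eq_0_iff by blast
    then show ?thesis
      using False unfolding N_def by (simp only: if_False)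
  qed
qed

end

section \<open>Power sums of slopes as permanents\<close>

lemma base_digits_unique:
  fixes c d :: "nat \<Rightarrow> nat"
  assumes "\<And>i. i < n \<Longrightarrow> c i < b" "\<And>i. i < n \<Longrightarrow> d i < b"
    and "(\<Sum>i<n. c i * b ^ i) = (\<Sum>i<n. d i * b ^ i)" and "i < n"
  shows "c i = d i"
  using assms
proof (induction n arbitrary: c d i)
  case 0
  then show ?case by simp
next
  case (Suc n)
  have split: "(\<Sum>i<Suc n. e i * b ^ i) = e 0 + b * (\<Sum>i<n. e (Suc i) * b ^ i)" for e :: "nat \<Rightarrow> nat"
    by (simp add: sum.lessThan_Suc_shift sum_distrib_left mult.left_commute del: sum.lessThan_Suc)
  have digits: "c 0 < b" "d 0 < b"
    using Suc.prems(1,2) by auto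
  have eq: "c 0 + b * (\<Sum>i<n. c (Suc i) * b ^ i) = d 0 + b * (\<Sum>i<n. d (Suc i) * b ^ i)"
    using Suc.prems(3) unfolding split .
  from arg_cong[OF eq, of "\<lambda>m. m mod b"] digits have "c 0 = d 0"
    by simp
  moreover from arg_cong[OF eq, of "\<lambda>m. m div b"] digits
  have "(\<Sum>i<n. c (Suc i) * b ^ i) = (\<Sum>i<n. d (Suc i) * b ^ i)"
    by simp
  then have "c (Suc k) = d (Suc k)" if "k < n" for k
    using Suc.IH[of "\<lambda>i. c (Suc i)" "\<lambda>i. d (Suc i)" k] Suc.prems(1,2) that by simp
  ultimately show ?case
    using Suc.prems(4) by (cases i) auto
qed

definition column_orderings :: "nat \<Rightarrow> (nat \<times> nat \<times> nat) set" where
  "column_orderings t = {(0, 1, t), (0, t, 1), (1, 0, t), (1, t, 0), (t, 0, 1), (t, 1, 0)}"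

text \<open>
The permanent of the \<open>3 \<times> 3\<close> matrix with rows \<open>a\<close>, \<open>b\<close>, \<open>c\<close>, restricted to the columns \<open>0\<close>, \<open>1\<close>, \<open>t\<close>.
\<close>

definition column_permanent :: "nat \<Rightarrow> (nat \<Rightarrow> 'a::field) \<Rightarrow> (nat \<Rightarrow> 'a) \<Rightarrow> (nat \<Rightarrow> 'a) \<Rightarrow> 'a" where
  "column_permanent t a b c = (\<Sum>(i, j, l)\<in>column_orderings t. a i * b j * c l)"

lemma product_of_three_sums:
  fixes f g h :: "nat \<Rightarrow> 'b::comm_semiring_0"
  shows "(\<Sum>i\<in>I. f i) * (\<Sum>j\<in>J. g j) * (\<Sum>l\<in>K. h l) = (\<Sum>(i, j, l)\<in>I \<times> J \<times> K. f i * g j * h l)"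
proof -
  have "sum f I * (sum g J * sum h K) = (\<Sum>(i, j, l)\<in>I \<times> J \<times> K. f i * (g j * h l))"
    by (simp only: sum_product[of g] sum_product[of f] sum.cartesian_product case_prod_unfold fst_conv snd_conv)
  then show ?thesis
    by (simp only: mult.assoc)
qed

context quintic_field
begin

text \<open>
For \<open>q \<ge> 4\<close> the sum of three powers below \<open>q ^ 5\<close> has base-\<open>q\<close> digits at most \<open>3\<close> and stays below
\<open>q ^ 5 - 1\<close>, so the digits determine the exponents.  For \<open>q = 2\<close> and \<open>q = 3\<close> carries and reduction
modulo \<open>q ^ 5 - 1\<close> do occur, and all cases are inspected.
\<close>

lemma power_triple_unique_mod:
  assumes ijl: "i < 5" "j < 5" "l < 5" and t: "t = 2 \<or> t = 3"
    and eq: "(q ^ i + q ^ j + q ^ l) mod (q ^ 5 - 1) = (q ^ 0 + q ^ 1 + q ^ t) mod (q ^ 5 - 1)"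
  shows "(i, j, l) \<in> column_orderings t"
proof -
  consider "q = 2" | "q = 3" | "q \<ge> 4"
    using q_ge_2 by linarith
  then show ?thesis
  proof cases
    case 1
    have "\<forall>i\<in>{0,1,2,3,4}. \<forall>j\<in>{0,1,2,3,4}. \<forall>l\<in>{0,1,2,3,4}. \<forall>t\<in>{2,3}.
       (2 ^ i + 2 ^ j + 2 ^ l) mod 31 = (2 ^ 0 + 2 ^ 1 + 2 ^ t :: nat) mod 31
         \<longrightarrow> (i, j, l) \<in> column_orderings t"
      by (simp add: column_orderings_def)
    moreover have "i \<in> {0,1,2,3,4}" "j \<in> {0,1,2,3,4}" "l \<in> {0,1,2,3,4}" "t \<in> {2,3}"
      using ijl t by auto
    moreover have "(2 ^ i + 2 ^ j + 2 ^ l) mod 31 = (2 ^ 0 + 2 ^ 1 + 2 ^ t :: nat) mod 31"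
      using eq 1 by simp
    ultimately show ?thesis
      by blast
  next
    case 2
    have "\<forall>i\<in>{0,1,2,3,4}. \<forall>j\<in>{0,1,2,3,4}. \<forall>l\<in>{0,1,2,3,4}. \<forall>t\<in>{2,3}.
       (3 ^ i + 3 ^ j + 3 ^ l) mod 242 = (3 ^ 0 + 3 ^ 1 + 3 ^ t :: nat) mod 242
         \<longrightarrow> (i, j, l) \<in> column_orderings t"
      by (simp add: column_orderings_def)
    moreover have "i \<in> {0,1,2,3,4}" "j \<in> {0,1,2,3,4}" "l \<in> {0,1,2,3,4}" "t \<in> {2,3}"
      using ijl t by auto
    moreover have "(3 ^ i + 3 ^ j + 3 ^ l) mod 242 = (3 ^ 0 + 3 ^ 1 + 3 ^ t :: nat) mod 242"
      using eq 2 by simp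
    ultimately show ?thesis
      by blast
  next
    case 3
    define digit where "digit = (\<lambda>i j l m :: nat. of_bool (m = i) + of_bool (m = j) + of_bool (m = l) :: nat)"
    have expand: "(\<Sum>m<5. digit i j l m * q ^ m) = q ^ i + q ^ j + q ^ l"
      if "i < 5" "j < 5" "l < 5" for i j l
      using that
      by (simp add: digit_def add_mult_distrib sum.distrib of_bool_def if_distrib[of "\<lambda>z. z * _"]
          sum.delta cong: if_cong del: sum.lessThan_Suc)
    have small: "q ^ i + q ^ j + q ^ l < q ^ 5 - 1" if "i < 5" "j < 5" "l < 5" for i j l
    proof -
      have "q ^ i \<le> q ^ 4" if "i < 5" for i
        using that q_ge_2 by (intro power_increasing) auto
      from this[OF that(1)] this[OF that(2)] this[OF that(3)]
      have "q ^ i + q ^ j + q ^ l \<le> 3 * q ^ 4"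
        by linarith
      moreover have "4 * q ^ 4 \<le> q * q ^ 4"
        using 3 by (intro mult_right_mono) auto
      moreover have "q * q ^ 4 = q ^ 5"
        by (simp flip: power_Suc)
      moreover have "q ^ 4 > 1"
        using q_ge_2 by (intro one_less_power) auto
      ultimately show ?thesis
        by linarith
    qed
    have t5: "t < 5" using t by auto
    have "q ^ i + q ^ j + q ^ l = q ^ 0 + q ^ 1 + q ^ t"
      using eq small[OF ijl] small[of 0 1 t] t5 by simp
    then have "(\<Sum>m<5. digit i j l m * q ^ m) = (\<Sum>m<5. digit 0 1 t m * q ^ m)"
      using expand[OF ijl] expand[of 0 1 t] t5 by simp
    then have digits_eq: "digit i j l m = digit 0 1 t m" if "m < 5" for m
      using base_digits_unique[of 5 "digit i j l" q "digit 0 1 t" m] 3 that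
      by (simp add: digit_def of_bool_def)
    have "0 \<noteq> t" "1 \<noteq> t"
      using t by auto
    have "digit i j l m = 1" if "m \<in> {0, 1, t}" for m
    proof -
      have "digit 0 1 t m = 1"
        using that \<open>0 \<noteq> t\<close> \<open>1 \<noteq> t\<close> by (auto simp: digit_def)
      moreover have "m < 5"
        using that t5 by auto
      ultimately show ?thesis
        using digits_eq by simp
    qed
    then have once: "of_bool (m = i) + of_bool (m = j) + of_bool (m = l) = (1::nat)"
      if "m \<in> {0, 1, t}" for m
      using that unfolding digit_def by blast
    have exactly_one: "of_bool P + of_bool Q + of_bool R = (1::nat) \<Longrightarrow>
        P \<and> \<not> Q \<and> \<not> R \<or> \<not> P \<and> Q \<and> \<not> R \<or> \<not> P \<and> \<not> Q \<and> R" for P Q R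
      by (cases P; cases Q; cases R) simp_all
    have "0 \<in> {0, 1, t}" "1 \<in> {0, 1, t}" "t \<in> {0, 1, t}"
      by simp_all
    from this[THEN once, THEN exactly_one] \<open>0 \<noteq> t\<close> \<open>1 \<noteq> t\<close> show ?thesis
      unfolding column_orderings_def by (elim disjE conjE) simp_all
  qed
qed

text \<open>
Expanding the product of the three \<open>q\<close>-polynomials gives monomials \<open>x ^ (q ^ i + q ^ j + q ^ l)\<close>.
By orthogonality only those with \<open>{i, j, l} = {0, 1, t}\<close> survive, each with the value \<open>-1\<close>.
\<close>

lemma column_permanent_eq_power_sum:
  assumes t: "t = 2 \<or> t = 3"
  shows "(\<Sum>x\<in>-{0::'a}. lin_poly q a x * lin_poly q b x * lin_poly q c x / (x * x ^ q * x ^ (q ^ t)))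
    = - column_permanent t a b c"
proof -
  let ?I = "{..<5::nat} \<times> {..<5::nat} \<times> {..<5::nat}"
  define e where "e = (\<lambda>(i, j, l). q ^ i + q ^ j + q ^ l)"
  define co where "co = (\<lambda>(i, j, l). a i * b j * c l)"
  have "lin_poly q a x * lin_poly q b x * lin_poly q c x = (\<Sum>s\<in>?I. co s * x ^ e s)" for x
    unfolding lin_poly_def product_of_three_sums
    by (intro sum.cong) (auto simp: co_def e_def power_add)
  moreover have "x * x ^ q * x ^ (q ^ t) = x ^ e (0, 1, t)" for x :: 'a
    by (simp add: e_def power_add)
  ultimately have "(\<Sum>x\<in>-{0::'a}. lin_poly q a x * lin_poly q b x * lin_poly q c x / (x * x ^ q * x ^ (q ^ t)))
      = (\<Sum>x\<in>-{0}. \<Sum>s\<in>?I. co s * (x ^ e s / x ^ e (0, 1, t)))"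
    by (simp only: sum_divide_distrib times_divide_eq_right)
  also have "\<dots> = (\<Sum>s\<in>?I. co s * (\<Sum>x\<in>-{0}. x ^ e s / x ^ e (0, 1, t)))"
    by (subst sum.swap) (simp only: sum_distrib_left)
  also have "\<dots> = (\<Sum>s\<in>?I. if s \<in> column_orderings t then - co s else 0)"
  proof (rule sum.cong)
    fix s assume "s \<in> ?I"
    moreover have "e s = e (0, 1, t)" if "s \<in> column_orderings t"
      using that by (auto simp: column_orderings_def e_def)
    ultimately have "e s mod (q ^ 5 - 1) = e (0, 1, t) mod (q ^ 5 - 1) \<longleftrightarrow> s \<in> column_orderings t"
      using power_triple_unique_mod[OF _ _ _ t] by (auto simp: e_def)
    then show "co s * (\<Sum>x\<in>-{0}. x ^ e s / x ^ e (0, 1, t)) = (if s \<in> column_orderings t then - co s else 0)"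
      by (simp add: power_ratio_sum)
  qed simp
  also have "\<dots> = (\<Sum>s\<in>column_orderings t. - co s)"
    using t by (intro sum.mono_neutral_cong_right) (auto simp: column_orderings_def)
  also have "\<dots> = - column_permanent t a b c"
    by (simp add: sum_negf column_permanent_def co_def)
  finally show ?thesis .
qed

text \<open>
The points of slope \<open>z\<close> are the nonzero elements of the kernel of \<open>x \<mapsto> lin_poly q a x - z * x\<close>.  The
kernel is a nontrivial additive group, so its order vanishes in the field and removing \<open>0\<close>
leaves \<open>-1\<close>.
\<close>

lemma sum_over_slopes:
  fixes h :: "'a \<Rightarrow> 'a"
  shows "(\<Sum>x\<in>-{0}. h (lin_poly q a x / x)) = - (\<Sum>z\<in>(\<lambda>x. lin_poly q a x / x) ` (-{0}). h z)"
proof -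
  let ?s = "\<lambda>x::'a. lin_poly q a x / x"
  have "(\<Sum>x\<in>-{0}. h (?s x)) = (\<Sum>z\<in>?s ` (-{0}). \<Sum>x\<in>{x \<in> -{0}. ?s x = z}. h (?s x))"
    by (rule sum.image_gen) (rule finite_subset_field)
  also have "\<dots> = (\<Sum>z\<in>?s ` (-{0}). - h z)"
  proof (rule sum.cong)
    fix z assume "z \<in> ?s ` (-{0})"
    then obtain x where x: "x \<noteq> 0" "?s x = z" by auto
    define K where "K = {x. lin_poly q a x = z * x}"
    have "0 \<in> K"
      using lin_poly_diff[of a 0 0] by (simp add: K_def)
    have "of_nat (card K) = (0 :: 'a)"
      using x by (intro additive_subgroup_card_zero[of K x])
        (auto simp: K_def finite_subset_field lin_poly_add lin_poly_diff algebra_simps)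
    moreover have "{x \<in> -{0}. ?s x = z} = K - {0}"
      by (auto simp: K_def)
    moreover have "Suc (card (K - {0})) = card K"
      using \<open>0 \<in> K\<close> finite_subset_field by (intro card_Suc_Diff1)
    ultimately have "of_nat (card {x \<in> -{0}. ?s x = z}) = (-1 :: 'a)"
      by (metis add.inverse_unique of_nat_Suc)
    then show "(\<Sum>x\<in>{x \<in> -{0}. ?s x = z}. h (?s x)) = - h z"
      by simp
  qed simp
  also have "\<dots> = - (\<Sum>z\<in>?s ` (-{0}). h z)"
    by (rule sum_negf)
  finally show ?thesis .
qed

end

section \<open>Linearized polynomials with the slopes of the Frobenius map\<close>

abbreviation unit_coeffs :: "nat \<Rightarrow> nat \<Rightarrow> 'a::field" where
  "unit_coeffs k \<equiv> (\<lambda>i. if i = k then 1 else 0)"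

context quintic_field
begin

text \<open>
The permanents belonging to five power sums are compared with those of \<open>x ^ q\<close>, which all
vanish.  Unit vectors are used as rows of the matrix when fewer than three factors are
needed.  The five resulting equations leave room for a single nonzero coefficient, and it is not
\<open>a 0\<close>.
\<close>

lemma monomial_if_frobenius_slopes:
  assumes slopes: "(\<lambda>x. lin_poly q a x / x) ` (-{0}) = (\<lambda>x::'a. x ^ q / x) ` (-{0})"
  shows "\<exists>m\<in>{1, 2, 3, 4}. \<forall>i<5. i \<noteq> m \<longrightarrow> a i = 0"
proof -
  let ?u = "unit_coeffs :: nat \<Rightarrow> nat \<Rightarrow> 'a"
  let ?tw = "frobenius_twist q"
  have u: "lin_poly q (?u k) x = x ^ (q ^ k)" if "k < 5" for k x
    using that by (rule lin_poly_unit)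
  have tw: "lin_poly q (?tw s b) x = lin_poly q b x ^ (q ^ s)" if "s \<le> 5" for s b and x :: 'a
    using lin_poly_frobenius[OF that] by simp
  have sums: "(\<Sum>x\<in>-{0}. h (lin_poly q a x / x)) = (\<Sum>x\<in>-{0}. h (lin_poly q (?u 1) x / x))"
    for h :: "'a \<Rightarrow> 'a"
    unfolding sum_over_slopes[of h] using slopes u[of 1] by simp
  have permanents: "column_permanent t a b c = column_permanent t (?u 1) b' c'"
    if "t = 2 \<or> t = 3"
      and "\<And>x. x \<noteq> 0 \<Longrightarrow> lin_poly q a x * lin_poly q b x * lin_poly q c x / (x * x ^ q * x ^ (q ^ t))
        = h (lin_poly q a x / x)"
      and "\<And>x. x \<noteq> 0 \<Longrightarrow> lin_poly q (?u 1) x * lin_poly q b' x * lin_poly q c' x / (x * x ^ q * x ^ (q ^ t))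
        = h (lin_poly q (?u 1) x / x)"
    for t b c b' c' h
  proof -
    have "- column_permanent t a b c = (\<Sum>x\<in>-{0}. h (lin_poly q a x / x))"
      unfolding column_permanent_eq_power_sum[OF that(1), symmetric]
      by (intro sum.cong) (simp_all add: that(2))
    also have "\<dots> = (\<Sum>x\<in>-{0}. h (lin_poly q (?u 1) x / x))"
      by (rule sums)
    also have "\<dots> = - column_permanent t (?u 1) b' c'"
      unfolding column_permanent_eq_power_sum[OF that(1), symmetric]
      by (intro sum.cong) (simp_all add: that(3) del: One_nat_def)
    finally show ?thesis
      by simp
  qed
  have q0: "q > 0" "q \<noteq> 0"
    using q_ge_2 by auto
  note ev = column_permanent_def column_orderings_def frobenius_twist_def power_0_left q0
  have "column_permanent 2 a (?u 1) (?u 2) = column_permanent 2 (?u 1) (?u 1) (?u 2)"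
    by (rule permanents[of 2 "?u 1" "?u 2" "\<lambda>z. z"]) (simp_all add: u)
  then have a0: "a 0 = 0"
    by (simp add: ev)
  have "column_permanent 2 a (?tw 1 a) (?u 2) = column_permanent 2 (?u 1) (?tw 1 (?u 1)) (?u 2)"
    by (rule permanents[of 2 "?tw 1 a" "?u 2" "\<lambda>z. z * z ^ q"]) (simp_all add: u tw power_divide del: One_nat_def)
  then have a14: "a 1 * a 4 ^ q = 0"
    by (simp add: ev a0)
  have "column_permanent 2 a (?u 1) (?tw 2 a) = column_permanent 2 (?u 1) (?u 1) (?tw 2 (?u 1))"
    by (rule permanents[of 2 "?u 1" "?tw 2 a" "\<lambda>z. z * z ^ (q ^ 2)"]) (simp_all add: u tw power_divide)
  then have a23: "a 2 * a 3 ^ (q ^ 2) = 0"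
    by (simp add: ev a0)
  have "column_permanent 2 a (?tw 1 a) (?tw 2 a) = column_permanent 2 (?u 1) (?tw 1 (?u 1)) (?tw 2 (?u 1))"
    by (rule permanents[of 2 "?tw 1 a" "?tw 2 a" "\<lambda>z. z * z ^ q * z ^ (q ^ 2)"])
      (simp_all add: u tw power_divide del: One_nat_def)
  then have c2: "a 1 * a 1 ^ q * a 3 ^ (q ^ 2) + a 2 * a 4 ^ q * a 4 ^ (q ^ 2) = 0"
    by (simp add: ev a0)
  have "column_permanent 3 a (?tw 1 a) (?tw 3 a) = column_permanent 3 (?u 1) (?tw 1 (?u 1)) (?tw 3 (?u 1))"
    by (rule permanents[of 3 "?tw 1 a" "?tw 3 a" "\<lambda>z. z * z ^ q * z ^ (q ^ 3)"])
      (simp_all add: u tw power_divide del: One_nat_def)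
  then have c3: "a 1 * a 2 ^ q * a 2 ^ (q ^ 3) + a 3 * a 4 ^ q * a 3 ^ (q ^ 3) = 0"
    by (simp add: ev a0 flip: numeral_2_eq_2)
  have five: "P 0 \<Longrightarrow> P 1 \<Longrightarrow> P 2 \<Longrightarrow> P 3 \<Longrightarrow> P 4 \<Longrightarrow> \<forall>i<5. P i" for P :: "nat \<Rightarrow> bool"
    by (auto simp: less_Suc_eq numeral_eq_Suc)
  consider "a 1 \<noteq> 0" | "a 4 \<noteq> 0" | "a 1 = 0" "a 4 = 0" "a 2 \<noteq> 0" | "a 1 = 0" "a 4 = 0" "a 2 = 0"
    by blast
  then show ?thesis
  proof cases
    case 1
    then have "a 4 = 0" using a14 q0 by simp
    moreover from this 1 c2 have "a 3 = 0" using q0 by (simp add: power_0_left)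
    moreover from this 1 c3 have "a 2 = 0" using q0 by (simp add: power_0_left)
    ultimately show ?thesis
      by (intro bexI[of _ 1] five) (simp_all add: a0)
  next
    case 2
    then have "a 1 = 0" using a14 q0 by simp
    moreover from this 2 c2 have "a 2 = 0" using q0 by (simp add: power_0_left)
    moreover from this 2 c3 have "a 3 = 0" using q0 by (simp add: power_0_left)
    ultimately show ?thesis
      by (intro bexI[of _ 4] five) (simp_all add: a0)
  next
    case 3
    then have "a 3 = 0" using a23 q0 by simp
    with 3 show ?thesis
      by (intro bexI[of _ 2] five) (simp_all add: a0)
  next
    case 4
    then show ?thesis
      by (intro bexI[of _ 3] five) (simp_all add: a0)
  qed
qed

section \<open>Norms and common roots\<close>

lemma norm5_mult: "norm5 q (x * y :: 'a) = norm5 q x * norm5 q y"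
  by (simp add: norm5_def power_mult_distrib prod.distrib)

lemma norm5_power: "norm5 q (x ^ m :: 'a) = norm5 q x ^ m"
  by (simp add: norm5_def prod_power_distrib mult.commute flip: power_mult)

lemma norm5_eq_0_iff: "norm5 q (x :: 'a) = 0 \<longleftrightarrow> x = 0"
  using q_ge_2 by (auto simp: norm5_def intro: exI[of _ 0])

lemma norm5_frobenius: "norm5 q (x ^ (q ^ s) :: 'a) = norm5 q x"
proof -
  have step: "norm5 q (y ^ q) = norm5 q y" for y :: 'a
  proof -
    have "norm5 q (y ^ q) = (\<Prod>i<5. y ^ (q ^ Suc i))"
      by (simp add: norm5_def flip: power_mult)
    also have "y * \<dots> = (\<Prod>i<5. y ^ (q ^ i)) * y ^ (q ^ 5)"
      using prod.lessThan_Suc_shift[of "\<lambda>i. y ^ (q ^ i)" 5] by (simp only: prod.lessThan_Suc power_0 power_one_right)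
    also have "\<dots> = y * norm5 q y"
      by (simp add: norm5_def frobenius_order_5 mult.commute)
    finally show ?thesis
      using q_ge_2 by (cases "y = 0") (auto simp: power_0_left)
  qed
  show ?thesis
    by (induction s) (simp_all add: step power_mult mult.commute[of q])
qed

text \<open>
Lagrange's resolvent: with \<open>c i = b * b ^ q * \<dots> * b ^ q ^ (i - 1)\<close>, the operator \<open>z \<mapsto> b * z ^ q\<close> shifts
the terms of \<open>lin_poly q c x\<close> cyclically, because \<open>c 5\<close> is the norm of \<open>b\<close>, which is \<open>1\<close>.  The resolvent is not
identically zero, since \<open>c 0 = 1\<close>.
\<close>

lemma hilbert90:
  assumes "norm5 q b = (1 :: 'a)"
  shows "\<exists>z. z \<noteq> 0 \<and> b * z ^ q = z"
proof -
  define c where "c i = (\<Prod>k<i. b ^ (q ^ k))" for i :: nat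
  have c_Suc: "b * c i ^ q = c (Suc i)" for i
  proof -
    have "c (Suc i) = b * (\<Prod>k<i. b ^ (q ^ Suc k))"
      by (simp add: c_def prod.lessThan_Suc_shift del: prod.lessThan_Suc)
    also have "(\<Prod>k<i. b ^ (q ^ Suc k)) = c i ^ q"
      unfolding c_def by (simp add: mult.commute[of q] prod_power_distrib flip: power_mult)
    finally show ?thesis ..
  qed
  have "c 0 = 1" "c 5 = 1"
    using assms by (simp_all add: c_def norm5_def)
  have fixed: "b * lin_poly q c x ^ q = lin_poly q c x" for x
  proof -
    have "b * lin_poly q c x ^ q = b * (\<Sum>i<5. (c i * x ^ (q ^ i)) ^ q)"
      using frobenius_sum[of "\<lambda>i. c i * x ^ (q ^ i)" "{..<5}" 1] by (simp only: lin_poly_def power_one_right)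
    also have "\<dots> = (\<Sum>i<5. c (Suc i) * x ^ (q ^ Suc i))"
      by (simp add: sum_distrib_left power_mult_distrib mult.commute[of q] mult.assoc
          flip: c_Suc power_mult del: sum.lessThan_Suc)
    finally have "x + b * lin_poly q c x ^ q = x + (\<Sum>i<5. c (Suc i) * x ^ (q ^ Suc i))"
      by simp
    also have "\<dots> = (\<Sum>i<Suc 5. c i * x ^ (q ^ i))"
      using \<open>c 0 = 1\<close> by (simp only: sum.lessThan_Suc_shift power_0 power_one_right mult_1)
    also have "\<dots> = lin_poly q c x + x"
      using \<open>c 5 = 1\<close> by (simp only: sum.lessThan_Suc lin_poly_def frobenius_order_5 mult_1)
    finally show ?thesis
      by (simp add: add.commute)
  qed
  have "\<exists>x. lin_poly q c x \<noteq> 0"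
  proof (rule ccontr)
    assume "\<not> ?thesis"
    then have "lin_poly q c x = lin_poly q (\<lambda>i. 0) x" for x
      by (simp add: lin_poly_def)
    then have "c 0 = 0"
      using lin_poly_eqD[of c "\<lambda>i. 0" 0] by simp
    with \<open>c 0 = 1\<close> show False by simp
  qed
  then show ?thesis
    using fixed by blast
qed

text \<open>
A common root \<open>x\<close> gives \<open>\<alpha> = x / x ^ q\<^sup>2\<close> and \<open>\<beta> = x ^ q / x ^ q\<^sup>2\<close>, whence all three conditions.  Conversely,
Hilbert 90 yields \<open>z\<close> with \<open>\<beta> = z / z ^ q\<close>; its \<open>q\<close>-th root is a root of the second polynomial, and
\<open>\<alpha> ^ q = \<beta> ^ (q + 1)\<close> makes it a root of the first.
\<close>

lemma common_root_iff:
  fixes \<alpha> \<beta> :: 'a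
  shows "(\<exists>x. x \<noteq> 0 \<and> x - \<alpha> * x ^ (q ^ 2) = 0 \<and> x ^ q - \<beta> * x ^ (q ^ 2) = 0)
    \<longleftrightarrow> \<alpha> ^ q = \<beta> ^ (q + 1) \<and> norm5 q \<alpha> = 1 \<and> norm5 q \<beta> = 1" (is "?L \<longleftrightarrow> ?R")
proof
  assume ?L
  then obtain x where x: "x \<noteq> 0" "\<alpha> * x ^ (q ^ 2) = x" "\<beta> * x ^ (q ^ 2) = x ^ q"
    by auto
  have "norm5 q \<alpha> * norm5 q x = norm5 q x"
    using arg_cong[OF x(2), of "norm5 q"] by (simp add: norm5_mult norm5_frobenius)
  moreover have "norm5 q \<beta> * norm5 q x = norm5 q x"
    using arg_cong[OF x(3), of "norm5 q"] norm5_frobenius[of x 1] by (simp add: norm5_mult norm5_frobenius)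
  moreover have "\<alpha> ^ q * (x ^ (q ^ 2)) ^ q = \<beta> ^ (q + 1) * (x ^ (q ^ 2)) ^ q"
  proof -
    have xqq: "(\<beta> * x ^ (q ^ 2)) ^ q = x ^ (q ^ 2)"
      unfolding x(3) by (simp add: power2_eq_square power_mult)
    have "\<alpha> ^ q * (x ^ (q ^ 2)) ^ q = \<beta> * x ^ (q ^ 2)"
      using arg_cong[OF x(2), of "\<lambda>z. z ^ q"] by (simp add: power_mult_distrib x(3))
    also have "\<dots> = \<beta> * (\<beta> * x ^ (q ^ 2)) ^ q"
      by (simp only: xqq)
    finally show ?thesis
      by (simp add: power_mult_distrib algebra_simps)
  qed
  ultimately show ?R
    using \<open>x \<noteq> 0\<close> by (simp add: norm5_eq_0_iff)
next
  assume R: ?R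
  then obtain z where z: "z \<noteq> 0" "\<beta> * z ^ q = z"
    using hilbert90 by blast
  \<comment> \<open>the unique \<open>q\<close>-th root of \<open>z\<close>\<close>
  define x where "x = z ^ (q ^ 4)"
  have xq: "x ^ q = z"
    using frobenius_order_5[of z] by (simp add: x_def numeral_eq_Suc mult.commute flip: power_mult)
  have xqq: "x ^ (q ^ 2) = z ^ q"
    by (simp add: xq power2_eq_square power_mult)
  have "(\<alpha> * z ^ q) ^ q = \<beta> * (\<beta> * z ^ q) ^ q"
    using R by (simp add: power_mult_distrib algebra_simps)
  also have "\<dots> = x ^ q"
    by (simp add: z xq)
  finally have "\<alpha> * z ^ q = x"
    using frobenius_inj[of _ 1] by simp
  then show ?L
    using z xq xqq by (intro exI[of _ x]) (auto simp: x_def)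
qed

end

section \<open>Linear sets and their projective images\<close>

lemma span_eq_imp_multiple:
  assumes "vec.span {v :: 'b::field ^ 'n} = vec.span {w}"
  obtains k where "w = k *s v"
proof -
  have "w \<in> vec.span {v}"
    unfolding assms by (simp add: vec.span_base)
  then show ?thesis
    using that by (auto simp: vec.span_singleton)
qed

lemma image_span_singleton:
  "(\<lambda>v. A *v v) ` vec.span {w :: 'b::field ^ 'n} = vec.span {A *v w}"
  by (simp add: vec.span_singleton image_image vector_scalar_commute)

lemma matrix_vector_mult_2:
  "(A :: 'b::field ^ 2 ^ 2) *v vector [x, y] = vector [A $ 1 $ 1 * x + A $ 1 $ 2 * y, A $ 2 $ 1 * x + A $ 2 $ 2 * y]"
  by (simp add: vec_eq_iff forall_2 matrix_vector_mult_def sum_2)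

lemma vector_2_eq_iff: "(vector [x, y] :: 'b::zero ^ 2) = vector [x', y'] \<longleftrightarrow> x = x' \<and> y = y'"
  by (simp add: vec_eq_iff forall_2)

lemma vector_2_eq_0_iff: "(vector [x, y] :: 'b::zero ^ 2) = 0 \<longleftrightarrow> x = 0 \<and> y = 0"
  by (simp add: vec_eq_iff forall_2)

lemma linear_set_image:
  "(\<lambda>P. (\<lambda>v. A *v v) ` P) ` linear_set {f x | x. True} = {vec.span {A *v f x} | x. f x \<noteq> 0}"
proof -
  have "linear_set {f x | x. True} = (\<lambda>x. vec.span {f x}) ` {x. f x \<noteq> 0}"
    by (auto simp: linear_set_def)
  then show ?thesis
    by (simp add: image_image image_span_singleton setcompr_eq_image)
qed

text \<open>
The coefficients of \<open>a * f + b * g\<close>, where \<open>f\<close> and \<open>g\<close> are the two coordinates of the vectors in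
\<open>U_set q \<alpha> \<beta>\<close>.
\<close>

definition U_coeffs :: "'a::field \<Rightarrow> 'a \<Rightarrow> 'a \<Rightarrow> 'a \<Rightarrow> nat \<Rightarrow> 'a" where
  "U_coeffs \<alpha> \<beta> a b i =
     (if i = 0 then a else if i = 1 then b else if i = 2 then - (a * \<alpha> + b * \<beta>) else 0)"

context quintic_field
begin

lemma lin_poly_U_coeffs:
  "lin_poly q (U_coeffs \<alpha> \<beta> a b) (x :: 'a)
    = a * (x - \<alpha> * x ^ (q ^ 2)) + b * (x ^ q - \<beta> * x ^ (q ^ 2))"
  by (simp add: lin_poly_def U_coeffs_def eval_nat_numeral algebra_simps)

text \<open>
The vectors of \<open>U_set q \<alpha> \<beta>\<close> depend additively on a parameter \<open>x\<close> with \<open>q ^ 5\<close> values, and a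
\<open>d\<close>-dimensional space has \<open>q ^ d\<close> elements, so the dimension is \<open>5\<close> exactly when no nonzero \<open>x\<close> gives
the zero vector.
\<close>

lemma rank_less_5_iff:
  fixes \<iota> :: "'k::field \<Rightarrow> 'a"
  assumes card_k: "CARD('k) = q" and emb: "field_embedding \<iota>"
  shows "linear_set_rank \<iota> (U_set q \<alpha> \<beta>) < 5
    \<longleftrightarrow> (\<exists>x. x \<noteq> 0 \<and> x - \<alpha> * x ^ (q ^ 2) = 0 \<and> x ^ q - \<beta> * x ^ (q ^ 2) = 0)"
proof -
  interpret vector_space "restr_scale \<iota>"
    using emb by (rule vector_space_restr_scale)
  define f where "f x = (vector [x - \<alpha> * x ^ (q ^ 2), x ^ q - \<beta> * x ^ (q ^ 2)] :: 'a ^ 2)" for x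
  have U: "U_set q \<alpha> \<beta> = range f"
    by (auto simp: U_set_def f_def)
  have fin_k: "finite (UNIV :: 'k set)"
    using card_k q_ge_2 by (metis card.infinite not_numeral_le_zero)
  have hom: "\<iota> (c * d) = \<iota> c * \<iota> d" "\<iota> 1 = 1" for c d
    using emb by (auto simp: field_embedding_def)
  have "\<iota> (c ^ m) = \<iota> c ^ m" for c m
    by (induction m) (simp_all add: hom)
  then have fixed: "\<iota> c ^ q = \<iota> c" for c
    using finite_field_power_card[OF fin_k, of c] card_k by metis
  then have fixed2: "\<iota> c ^ (q ^ 2) = \<iota> c" for c
    by (simp add: power2_eq_square power_mult)
  have f_add: "f (x + y) = f x + f y" for x y
    using frobenius_add[of x y 1] frobenius_add[of x y 2]
    by (simp add: f_def vec_eq_iff forall_2 algebra_simps)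
  have f_diff: "f (x - y) = f x - f y" for x y
    using f_add[of "x - y" y] by simp
  have f_scale: "f (\<iota> c * x) = restr_scale \<iota> c (f x)" for c x
    by (simp add: f_def restr_scale_def vec_eq_iff forall_2 power_mult_distrib fixed fixed2 algebra_simps)
  have "subspace (range f)"
    by (rule subspaceI) (use f_diff[of 0 0] in \<open>auto simp flip: f_add f_scale\<close>)
  then have "card (range f) = q ^ dim (range f)"
    using card_subspace[OF fin_k] finite_imageI[OF finite_subset_field] card_k by metis
  moreover have "card (range f) \<le> q ^ 5"
    using card_image_le[OF finite_subset_field, of f UNIV] by (simp add: card_field)
  moreover have "card (range f) = q ^ 5 \<longleftrightarrow> inj f"
    using eq_card_imp_inj_on[OF finite_subset_field, of f UNIV] card_image[of f UNIV] card_field by auto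
  moreover have "q ^ dim (range f) < q ^ 5 \<longleftrightarrow> dim (range f) < 5"
    using q_ge_2 by simp
  ultimately have "dim (range f) < 5 \<longleftrightarrow> \<not> inj f"
    by (metis nat_less_le)
  also have "\<dots> \<longleftrightarrow> (\<exists>x. x \<noteq> 0 \<and> f x = 0)"
  proof
    assume "\<not> inj f"
    then obtain x y where "f x = f y" "x \<noteq> y"
      by (auto simp: inj_def)
    then show "\<exists>x. x \<noteq> 0 \<and> f x = 0"
      using f_diff[of x y] by (intro exI[of _ "x - y"]) simp
  next
    assume "\<exists>x. x \<noteq> 0 \<and> f x = 0"
    moreover have "f 0 = 0"
      using f_diff[of 0 0] by simp
    ultimately show "\<not> inj f"
      by (metis injD)
  qed
  finally show ?thesis
    unfolding linear_set_rank_def U by (simp add: f_def vector_2_eq_0_iff)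
qed

text \<open>
With \<open>\<gamma> ^ q = \<beta>\<close> and \<open>h x = x - \<gamma> * x ^ q\<close>, the hypothesis on \<open>\<alpha>\<close> says \<open>\<alpha> = \<gamma> * \<beta>\<close>, and the two coordinates
become \<open>h + \<gamma> * h ^ q\<close> and \<open>h ^ q\<close>.  A nonzero root of \<open>h\<close> would force \<open>\<gamma>\<close>, hence \<open>\<beta>\<close>, to have norm \<open>1\<close>.
\<close>

lemma pseudoregulus_type_if_norm_ne_1:
  fixes \<alpha> \<beta> :: 'a
  assumes eq: "\<alpha> ^ q = \<beta> ^ (q + 1)" and norm: "norm5 q \<beta> \<noteq> 1"
  shows "pseudoregulus_type q (L_set q \<alpha> \<beta>)"
proof -
  define \<gamma> where "\<gamma> = \<beta> ^ (q ^ 4)"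
  have \<gamma>q: "\<gamma> ^ q = \<beta>"
    using frobenius_order_5[of \<beta>] by (simp add: \<gamma>_def numeral_eq_Suc mult.commute flip: power_mult)
  have "\<alpha> ^ q = (\<gamma> * \<beta>) ^ q"
    by (simp add: eq power_mult_distrib \<gamma>q)
  then have \<alpha>: "\<alpha> = \<gamma> * \<beta>"
    using frobenius_inj[of _ 1] by simp
  define h where "h x = x - \<gamma> * x ^ q" for x
  have hq: "h x ^ q = x ^ q - \<beta> * x ^ (q ^ 2)" for x
    using frobenius_diff[of x "\<gamma> * x ^ q" 1]
    by (simp add: h_def power_mult_distrib \<gamma>q power2_eq_square power_mult)
  have h0: "x = 0" if "h x = 0" for x
  proof (rule ccontr)
    assume "x \<noteq> 0"
    have "x = \<gamma> * x ^ (q ^ 1)"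
      using that by (simp add: h_def)
    then have "norm5 q x = norm5 q \<gamma> * norm5 q x"
      using norm5_mult[of \<gamma> "x ^ (q ^ 1)"] norm5_frobenius[of x 1] by simp
    with \<open>x \<noteq> 0\<close> have "norm5 q \<gamma> = 1"
      by (simp add: norm5_eq_0_iff)
    with norm show False
      by (simp add: \<gamma>_def norm5_frobenius)
  qed
  have h_diff: "h (x - y) = h x - h y" for x y
  proof -
    have "(x - y) ^ q = x ^ q - y ^ q"
      using frobenius_diff[of x y 1] by simp
    then show ?thesis
      by (simp add: h_def right_diff_distrib)
  qed
  have "inj h"
    using h0 h_diff by (metis injI right_minus_eq)
  then have "surj h"
    using finite_UNIV_inj_surj finite_subset_field by blast
  define A :: "'a ^ 2 ^ 2" where "A = vector [vector [1, - \<gamma>], vector [0, 1]]"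
  have "invertible A"
    by (simp add: invertible_det_nz det_2 A_def)
  have A: "A *v vector [x - \<alpha> * x ^ (q ^ 2), x ^ q - \<beta> * x ^ (q ^ 2)] = vector [h x, h x ^ q]" for x
    by (simp add: matrix_vector_mult_2 A_def vector_2_eq_iff hq) (simp add: h_def \<alpha> algebra_simps)
  have nz: "vector [x - \<alpha> * x ^ (q ^ 2), x ^ q - \<beta> * x ^ (q ^ 2)] \<noteq> (0 :: 'a ^ 2) \<longleftrightarrow> h x \<noteq> 0" for x
  proof -
    have "x - \<alpha> * x ^ (q ^ 2) = h x + \<gamma> * h x ^ q"
      unfolding hq by (simp add: h_def \<alpha> algebra_simps)
    then show ?thesis
      using q_ge_2 by (auto simp: vector_2_eq_0_iff simp flip: hq)
  qed
  have "(\<lambda>P. (\<lambda>v. A *v v) ` P) ` L_set q \<alpha> \<beta>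
      = {vec.span {A *v vector [x - \<alpha> * x ^ (q ^ 2), x ^ q - \<beta> * x ^ (q ^ 2)]} | x.
          vector [x - \<alpha> * x ^ (q ^ 2), x ^ q - \<beta> * x ^ (q ^ 2)] \<noteq> (0 :: 'a ^ 2)}"
    unfolding L_set_def U_set_def by (rule linear_set_image)
  also have "\<dots> = {vec.span {vector [h x, h x ^ q]} | x. h x \<noteq> 0}"
    unfolding A nz ..
  also have "\<dots> = {vec.span {vector [u, u ^ q]} | u. u \<noteq> 0}"
  proof -
    have "h ` {x. h x \<noteq> 0} = {u. u \<noteq> 0}"
      using \<open>surj h\<close> by (auto simp: surj_def image_iff)
    then show ?thesis
      using image_image[of "\<lambda>u. vec.span {vector [u, u ^ q] :: 'a ^ 2}" h "{x. h x \<noteq> 0}"]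
      by (simp only: setcompr_eq_image)
  qed
  finally have "(\<lambda>P. (\<lambda>v. A *v v) ` P) ` L_set q \<alpha> \<beta> = {vec.span {vector [u, u ^ q]} | u. u \<noteq> 0}" .
  with \<open>invertible A\<close> show ?thesis
    unfolding pseudoregulus_type_def proj_equivalent_def by (intro exI[of _ A] conjI) (simp_all only:)
qed

text \<open>
No point \<open>(u, u ^ q)\<close> with \<open>u \<noteq> 0\<close> has first coordinate \<open>0\<close>, so points can be replaced by their slopes.
\<close>

lemma slopes_of_pseudoregulus:
  fixes F G :: "'a \<Rightarrow> 'a"
  assumes nz: "\<And>x. x \<noteq> 0 \<Longrightarrow> vector [F x, G x] \<noteq> (0 :: 'a ^ 2)"
    and sets: "{vec.span {vector [F x, G x] :: 'a ^ 2} | x. x \<noteq> 0} = {vec.span {vector [u, u ^ q]} | u. u \<noteq> 0}"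
  shows "\<And>x. x \<noteq> 0 \<Longrightarrow> F x \<noteq> 0"
    and "(\<lambda>x. G x / F x) ` (-{0}) = (\<lambda>u. u ^ q / u) ` (-{0})"
proof -
  have same_point: "F x \<noteq> 0 \<and> G x / F x = u ^ q / u"
    if "x \<noteq> 0" and "u \<noteq> 0"
      and span: "vec.span {vector [F x, G x] :: 'a ^ 2} = vec.span {vector [u, u ^ q]}" for x u
  proof -
    obtain k where k: "vector [u, u ^ q] = k *s (vector [F x, G x] :: 'a ^ 2)"
      using span_eq_imp_multiple[OF span] .
    have "u = k * F x" "u ^ q = k * G x"
      using arg_cong[OF k, of "\<lambda>v. v $ 1"] arg_cong[OF k, of "\<lambda>v. v $ 2"] by simp_all
    with \<open>u \<noteq> 0\<close> have "k \<noteq> 0" "F x \<noteq> 0" "u ^ q / u = (k * G x) / (k * F x)"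
      by auto
    then show ?thesis
      by simp
  qed
  have fwd: "\<exists>u. u \<noteq> 0 \<and> F x \<noteq> 0 \<and> G x / F x = u ^ q / u" if "x \<noteq> 0" for x
  proof -
    have "vec.span {vector [F x, G x] :: 'a ^ 2} \<in> {vec.span {vector [u, u ^ q]} | u. u \<noteq> 0}"
      unfolding sets[symmetric] using that by blast
    then show ?thesis
      using same_point[OF that] by blast
  qed
  have bwd: "\<exists>x. x \<noteq> 0 \<and> G x / F x = u ^ q / u" if "u \<noteq> 0" for u
  proof -
    have "vec.span {vector [u, u ^ q] :: 'a ^ 2} \<in> {vec.span {vector [F x, G x]} | x. x \<noteq> 0}"
      unfolding sets using that by blast
    then show ?thesis
      using same_point that by blast
  qed
  show "F x \<noteq> 0" if "x \<noteq> 0" for x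
    using fwd[OF that] by blast
  show "(\<lambda>x. G x / F x) ` (-{0}) = (\<lambda>u. u ^ q / u) ` (-{0})"
  proof (rule equalityI; rule image_subsetI)
    fix x :: 'a assume "x \<in> -{0}"
    then obtain u where "u \<noteq> 0" "G x / F x = u ^ q / u"
      using fwd by auto
    then show "G x / F x \<in> (\<lambda>u. u ^ q / u) ` (-{0})"
      by simp
  next
    fix u :: 'a assume "u \<in> -{0}"
    then obtain x where "x \<noteq> 0" "G x / F x = u ^ q / u"
      using bwd by auto
    then show "u ^ q / u \<in> (\<lambda>x. G x / F x) ` (-{0})"
      by (intro image_eqI[of _ _ x]) simp_all
  qed
qed

text \<open>
The first \<open>q\<close>-polynomial \<open>F\<close> is bijective, and \<open>\<Phi> = G \<circ> F\<^sup>-\<^sup>1\<close> is a \<open>q\<close>-polynomial with the slopes of the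
Frobenius map, hence a monomial \<open>l * y ^ q ^ m\<close>.  So \<open>G = l * F ^ q ^ m\<close>, which is stated here for the
coefficients.
\<close>

lemma frobenius_related_if_slopes:
  assumes F0: "\<And>x::'a. x \<noteq> 0 \<Longrightarrow> lin_poly q a x \<noteq> 0"
    and slopes: "(\<lambda>x. lin_poly q b x / lin_poly q a x) ` (-{0}) = (\<lambda>u::'a. u ^ q / u) ` (-{0})"
  obtains m l where "m \<in> {1, 2, 3, 4}" "\<And>i. i < 5 \<Longrightarrow> b i = l * frobenius_twist q m a i"
proof -
  let ?F = "lin_poly q a :: 'a \<Rightarrow> 'a"
  have F_inj: "inj ?F"
  proof (rule injI)
    fix x y assume "?F x = ?F y"
    then have "?F (x - y) = 0"
      by (simp add: lin_poly_diff)
    then show "x = y"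
      using F0[of "x - y"] by auto
  qed
  obtain a' where a': "\<And>x. lin_poly q a' (?F x) = x"
    using lin_poly_left_inverse[OF F_inj] by blast
  obtain c where c: "\<And>x. lin_poly q b (lin_poly q a' x) = lin_poly q c x"
    using lin_poly_comp by metis
  have cF: "lin_poly q c (?F x) = lin_poly q b x" for x
    by (simp add: a' flip: c)
  have "?F 0 = 0"
    using lin_poly_diff[of a 0 0] by simp
  have "surj ?F"
    using F_inj finite_UNIV_inj_surj finite_subset_field by blast
  then have "?F ` (-{0}) = -{0}"
    using image_set_diff[OF F_inj, of UNIV "{0}"] \<open>?F 0 = 0\<close> by (simp add: Compl_eq_Diff_UNIV)
  then have "(\<lambda>y. lin_poly q c y / y) ` (-{0}) = (\<lambda>y. lin_poly q c y / y) ` ?F ` (-{0})"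
    by simp
  also have "\<dots> = (\<lambda>u::'a. u ^ q / u) ` (-{0})"
    unfolding image_image cF by (rule slopes)
  finally obtain m where m: "m \<in> {1, 2, 3, 4}" "\<And>i. i < 5 \<Longrightarrow> i \<noteq> m \<Longrightarrow> c i = 0"
    using monomial_if_frobenius_slopes by blast
  have "m < 5" using m(1) by auto
  have "lin_poly q c y = c m * y ^ (q ^ m)" for y
  proof -
    have "lin_poly q c y = (\<Sum>i<5. if i = m then c i * y ^ (q ^ i) else 0)"
      unfolding lin_poly_def using m(2) by (intro sum.cong) auto
    also have "\<dots> = c m * y ^ (q ^ m)"
      using \<open>m < 5\<close> by (simp only: sum.delta finite_lessThan lessThan_iff if_True)
    finally show ?thesis .
  qed
  then have "lin_poly q b x = c m * lin_poly q (frobenius_twist q m a) x" for x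
    using cF[of x] lin_poly_frobenius[of m a x] \<open>m < 5\<close> by simp
  then have "lin_poly q b x = lin_poly q (\<lambda>i. c m * frobenius_twist q m a i) x" for x
    by (simp add: lin_poly_def sum_distrib_left mult.assoc)
  then have "b i = c m * frobenius_twist q m a i" if "i < 5" for i
    by (rule lin_poly_eqD) (rule that)
  with m(1) show ?thesis
    by (rule that)
qed

text \<open>
The coefficient vectors of \<open>F\<close> and \<open>G\<close> are supported on \<open>{0, 1, 2}\<close>, and the \<open>m\<close>-fold cyclic shift of
the former is proportional to the latter.  For \<open>m = 2\<close> and \<open>m = 3\<close> the supports meet in one place
only, which makes \<open>F\<close> and \<open>G\<close> violate the determinant condition.  For \<open>m = 1\<close> they meet in two places,
which gives \<open>c = 0\<close>, \<open>b ^ q = - \<beta> * a ^ q\<close> and \<open>a * \<alpha> + b * \<beta> = 0\<close>; eliminating \<open>a\<close> and \<open>b\<close> gives the claim.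
The case \<open>m = 4\<close> is that of \<open>m = 1\<close> with the roles of \<open>F\<close> and \<open>G\<close> exchanged.
\<close>

lemma power_eq_if_frobenius_related:
  fixes \<alpha> \<beta> :: 'a
  assumes m: "m \<in> {1, 2, 3, 4}" and det: "a * d \<noteq> b * c"
    and rel: "\<And>i. i < 5 \<Longrightarrow> U_coeffs \<alpha> \<beta> c d i = l * frobenius_twist q m (U_coeffs \<alpha> \<beta> a b) i"
  shows "\<alpha> ^ q = \<beta> ^ (q + 1)"
proof -
  have q0: "q > 0" "q \<noteq> 0"
    using q_ge_2 by auto
  note ev = U_coeffs_def frobenius_twist_def power_0_left q0
  consider "m = 1" | "m = 2" | "m = 3" | "m = 4"
    using m by auto
  then show ?thesis
  proof cases
    case 1
    have c: "c = 0" and d: "d = l * a ^ q" and d': "- (c * \<alpha> + d * \<beta>) = l * b ^ q"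
      and s: "l * (- (a * \<alpha> + b * \<beta>)) ^ q = 0"
      using rel[of 0] rel[of 1] rel[of 2] rel[of 3] by (simp_all add: ev 1)
    have "d \<noteq> 0" "a \<noteq> 0"
      using det c by auto
    then have "l \<noteq> 0"
      using d by auto
    have "l * b ^ q = l * (- \<beta> * a ^ q)"
      using d' c d by (simp add: algebra_simps)
    then have b: "b ^ q = - \<beta> * a ^ q"
      using mult_left_cancel[OF \<open>l \<noteq> 0\<close>] by blast
    have "- (a * \<alpha> + b * \<beta>) = 0"
      using s \<open>l \<noteq> 0\<close> by (metis mult_eq_0_iff power_eq_0_iff)
    then have "a * \<alpha> = 0 - b * \<beta>"
      by (simp only: neg_equal_0_iff_equal eq_diff_eq)
    then have "(a * \<alpha>) ^ q = 0 - (b * \<beta>) ^ q"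
      using frobenius_diff[of 0 "b * \<beta>" 1] q0 by (simp add: power_0_left)
    then have "a ^ q * \<alpha> ^ q = a ^ q * \<beta> ^ (q + 1)"
      by (simp add: power_mult_distrib b algebra_simps)
    then show ?thesis
      using \<open>a \<noteq> 0\<close> by simp
  next
    case 2
    have "c = 0" "d = 0"
      using rel[of 0] rel[of 1] by (simp_all add: ev 2)
    then show ?thesis
      using det by simp
  next
    case 3
    have "l * a ^ (q ^ 3) = 0" "l * b ^ (q ^ 3) = 0" "c = l * (- (a * \<alpha> + b * \<beta>)) ^ (q ^ 3)" "d = 0"
      using rel[of 0] rel[of 1] rel[of 3] rel[of 4] by (simp_all add: ev 3)
    then show ?thesis
      using det by auto
  next
    case 4
    have a: "l * a ^ (q ^ 4) = 0" and c: "c = l * b ^ (q ^ 4)"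
      and d: "d = l * (- (a * \<alpha> + b * \<beta>)) ^ (q ^ 4)" and s: "- (c * \<alpha> + d * \<beta>) = 0"
      using rel[of 0] rel[of 1] rel[of 2] rel[of 4] by (simp_all add: ev 4)
    have "l \<noteq> 0"
      using det c d by auto
    then have "a = 0"
      using a q0 by simp
    then have "c \<noteq> 0"
      using det by auto
    have "d = l * (0 - b * \<beta>) ^ (q ^ 4)"
      using d \<open>a = 0\<close> by simp
    also have "\<dots> = - (c * \<beta> ^ (q ^ 4))"
      unfolding frobenius_diff using q0 by (simp add: power_0_left c power_mult_distrib)
    finally have "d = - (c * \<beta> ^ (q ^ 4))" .
    moreover have "c * \<alpha> = 0 - d * \<beta>"
      using s by (simp only: neg_equal_0_iff_equal eq_diff_eq)
    ultimately have "c * \<alpha> = c * (\<beta> ^ (q ^ 4) * \<beta>)"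
      by simp
    then have "\<alpha> = \<beta> ^ (q ^ 4) * \<beta>"
      using \<open>c \<noteq> 0\<close> by simp
    then show ?thesis
      using frobenius_order_5[of \<beta>]
      by (simp add: power_mult_distrib numeral_eq_Suc mult.commute flip: power_mult)
  qed
qed

lemma pseudoregulus_type_imp_power_eq:
  fixes \<alpha> \<beta> :: 'a
  assumes "pseudoregulus_type q (L_set q \<alpha> \<beta>)"
  shows "\<alpha> ^ q = \<beta> ^ (q + 1)"
proof (rule ccontr)
  assume neq: "\<alpha> ^ q \<noteq> \<beta> ^ (q + 1)"
  define f where "f x = x - \<alpha> * x ^ (q ^ 2)" for x
  define g where "g x = x ^ q - \<beta> * x ^ (q ^ 2)" for x
  have fg: "vector [f x, g x] \<noteq> (0 :: 'a ^ 2) \<longleftrightarrow> x \<noteq> 0" for x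
    using neq common_root_iff[of \<alpha> \<beta>] q_ge_2
    by (auto simp: vector_2_eq_0_iff f_def g_def power_0_left)
  obtain A :: "'a ^ 2 ^ 2" where "invertible A"
    and A: "{vec.span {vector [u, u ^ q]} | u :: 'a. u \<noteq> 0} = (\<lambda>P. (\<lambda>v. A *v v) ` P) ` L_set q \<alpha> \<beta>"
    using assms unfolding pseudoregulus_type_def proj_equivalent_def by blast
  define a b c d where "a = A $ 1 $ 1" and "b = A $ 1 $ 2" and "c = A $ 2 $ 1" and "d = A $ 2 $ 2"
  have det: "a * d \<noteq> b * c"
    using \<open>invertible A\<close> by (simp add: invertible_det_nz det_2 a_def b_def c_def d_def)
  let ?F = "lin_poly q (U_coeffs \<alpha> \<beta> a b) :: 'a \<Rightarrow> 'a"
  let ?G = "lin_poly q (U_coeffs \<alpha> \<beta> c d) :: 'a \<Rightarrow> 'a"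
  have Av: "A *v vector [f x, g x] = vector [?F x, ?G x]" for x
    by (simp add: matrix_vector_mult_2 lin_poly_U_coeffs f_def g_def a_def b_def c_def d_def)
  have nz: "vector [?F x, ?G x] \<noteq> (0 :: 'a ^ 2)" if "x \<noteq> 0" for x
  proof
    assume "vector [?F x, ?G x] = (0 :: 'a ^ 2)"
    then have "A *v vector [f x, g x] = A *v 0"
      by (simp add: Av)
    moreover have "inj ((*v) A)"
      using \<open>invertible A\<close> by (metis invertible_def matrix_left_invertible_injective)
    ultimately show False
      using fg[of x] that by (metis injD)
  qed
  have "(\<lambda>P. (\<lambda>v. A *v v) ` P) ` L_set q \<alpha> \<beta>
      = {vec.span {A *v vector [f x, g x]} | x. vector [f x, g x] \<noteq> (0 :: 'a ^ 2)}"
    unfolding L_set_def U_set_def f_def g_def by (rule linear_set_image)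
  then have "{vec.span {vector [?F x, ?G x] :: 'a ^ 2} | x. x \<noteq> 0} = {vec.span {vector [u, u ^ q]} | u. u \<noteq> 0}"
    unfolding A Av fg by simp
  note slopes = slopes_of_pseudoregulus[of ?F ?G, OF nz this]
  obtain m l where "m \<in> {1, 2, 3, 4}"
    "\<And>i. i < 5 \<Longrightarrow> U_coeffs \<alpha> \<beta> c d i = l * frobenius_twist q m (U_coeffs \<alpha> \<beta> a b) i"
    using frobenius_related_if_slopes[OF slopes] by metis
  then show False
    using power_eq_if_frobenius_related[OF _ det] neq by blast
qed

end

theorem proposition2p5:
  fixes q :: nat
    and \<iota> :: "'k::field \<Rightarrow> 'a::field"
    and \<alpha> \<beta> :: 'a
  assumes "primepow q"
    and "CARD('k) = q"
    and "CARD('a) = q ^ 5"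
    and "field_embedding \<iota>"
  shows "(linear_set_rank \<iota> (U_set q \<alpha> \<beta>) < 5 \<longleftrightarrow>
            \<alpha> ^ q = \<beta> ^ (q + 1) \<and> norm5 q \<alpha> = 1 \<and> norm5 q \<beta> = 1)
       \<and> (\<alpha> ^ q \<noteq> \<beta> ^ (q + 1) \<longrightarrow> \<not> pseudoregulus_type q (L_set q \<alpha> \<beta>))
       \<and> (\<alpha> ^ q = \<beta> ^ (q + 1) \<and> (norm5 q \<alpha>, norm5 q \<beta>) \<noteq> (1, 1) \<longrightarrow>
            pseudoregulus_type q (L_set q \<alpha> \<beta>))"
proof -
  interpret quintic_field q "TYPE('a)"
    using assms by unfold_locales
  have "norm5 q \<alpha> = 1" if "\<alpha> ^ q = \<beta> ^ (q + 1)" "norm5 q \<beta> = 1"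
  proof -
    have "norm5 q \<alpha> = norm5 q (\<alpha> ^ q)"
      using norm5_frobenius[of \<alpha> 1] by simp
    also have "\<dots> = 1"
      using that by (simp add: norm5_power norm5_mult)
    finally show ?thesis .
  qed
  then show ?thesis
    using rank_less_5_iff[OF assms(2,4), of \<alpha> \<beta>] common_root_iff[of \<alpha> \<beta>]
      pseudoregulus_type_imp_power_eq[of \<alpha> \<beta>] pseudoregulus_type_if_norm_ne_1[of \<alpha> \<beta>]
    by auto
qed

end
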